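(* Let $d\ge 1$, let $A\in GL_d(\mathbb{Q})$ be $\mathbb{Q}$-irreducible, and let $H\subset\mathbb{Q}^d$ be a subgroup with $A(H)=H$ and $\mathrm{rank}_{\mathbb{Q}}(H)=d$. Then the group $\mathbb{Z}\ltimes_A H$ has a faithful affine action on $\mathbb{R}$ (that is, an injective homomorphism into $\mathrm{Aff}_+(\mathbb{R})$) if and only if $A$ has a positive real eigenvalue.
   Context: The $\mathbb{Q}$-rank of $H$, $\mathrm{rank}_{\mathbb{Q}}(H)$, is the smallest $d'$ such that $H$ embeds into $\mathbb{Q}^{d'}$. $\mathbb{Z}\ltimes_A H$ is the semidirect product in which the generator $a$ of $\mathbb{Z}$ acts on $H$ by $a\,b\,a^{-1}=A(b)$, $b\in H$. $A$ is $\mathbb{Q}$-irreducible if it preserves no proper nonzero $\mathbb{Q}$-linear subspace of $\mathbb{Q}^d$. All actions are by orientation-preserving maps; $\mathrm{Aff}_+(\mathbb{R})$ is the group of maps $x\mapsto \lambda x+t$ with $\lambda>0$, $t\in\mathbb{R}$. *)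

theory Defs
  imports
    "HOL-Algebra.Elementary_Groups"
    "Jordan_Normal_Form.VS_Connect"
    "Jordan_Normal_Form.Char_Poly"
    Complex_Main
begin

abbreviation rat_vec_group :: "nat \<Rightarrow> rat vec monoid" where
  "rat_vec_group n \<equiv> monoid_vec TYPE(rat) n"

(* The group GL(n, Q); integer powers of an invertible matrix are powers in this group. *)
definition GL_rat :: "nat \<Rightarrow> rat mat monoid" where
  "GL_rat n = units_of (ring_mat TYPE(rat) n ())"

definition Q_irreducible :: "nat \<Rightarrow> rat mat \<Rightarrow> bool" where
  "Q_irreducible n A \<longleftrightarrow>
     (\<forall>W. VectorSpace.subspace class_ring W (module_vec TYPE(rat) n) \<and> (\<lambda>v. A *\<^sub>v v) ` W \<subseteq> W
          \<longrightarrow> W = {0\<^sub>v n} \<or> W = carrier_vec n)"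

(* Meaningful only if G embeds into some Q^m, as every subgroup of Q^n does;
   otherwise LEAST is unspecified. *)
definition Q_rank :: "('g, 'm) monoid_scheme \<Rightarrow> nat" where
  "Q_rank G = (LEAST m. \<exists>f. f \<in> mon G (rat_vec_group m))"

(* The pair (k, x) stands for the product x k, so that k x k^-1 = act k x. *)
definition semidirect_product ::
    "('k, 'a) monoid_scheme \<Rightarrow> ('k \<Rightarrow> 'n \<Rightarrow> 'n) \<Rightarrow> ('n, 'b) monoid_scheme \<Rightarrow> ('k \<times> 'n) monoid" where
  "semidirect_product K act N =
     \<lparr>carrier = carrier K \<times> carrier N,
      monoid.mult = (\<lambda>(k, x) (l, y). (k \<otimes>\<^bsub>K\<^esub> l, x \<otimes>\<^bsub>N\<^esub> act k y)),
      one = (\<one>\<^bsub>K\<^esub>, \<one>\<^bsub>N\<^esub>)\<rparr>"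

definition Z_semidirect :: "nat \<Rightarrow> rat mat \<Rightarrow> rat vec set \<Rightarrow> (int \<times> rat vec) monoid" where
  "Z_semidirect n A H =
     semidirect_product integer_group
       (\<lambda>k v. (A [^]\<^bsub>GL_rat n\<^esub> k) *\<^sub>v v)
       ((rat_vec_group n)\<lparr>carrier := H\<rparr>)"

definition Aff_plus :: "(real \<Rightarrow> real) monoid" where
  "Aff_plus =
     \<lparr>carrier = {f. \<exists>l t. l > 0 \<and> f = (\<lambda>x. l * x + t)},
      monoid.mult = (\<circ>),
      one = id\<rparr>"

end

(* A left eigenvector of A for a positive real eigenvalue l is a Q-linear functional \<phi> : Q^d \<rightarrow> R with
   \<phi>(A v) = l \<phi>(v); its kernel is A-invariant, so \<phi> is injective, and letting the generator of Z act as
   x \<mapsto> l x and v \<in> H as x \<mapsto> x + \<phi>(v) gives a faithful action. If l = 1, the generator acts instead as a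
   translation by some t with k t \<notin> \<phi>(Q^d) for all k \<noteq> 0.

   Conversely, let \<chi>(h) be the linear part of a faithful action at h \<in> H. Conjugating by the generator
   gives \<chi>(A h) = \<chi>(h), so the kernel K of \<chi> is A-invariant and contains all A h - h. If K = 0, then A
   fixes H and 1 is an eigenvalue. Otherwise K spans Q^d by irreducibility, so \<chi> is torsion and hence
   trivial. Thus H acts by translations, and the translation length extends to a functional on Q^d as
   above, with l > 0 the linear part of the generator. *)

theory Submission
  imports Defs "HOL-Analysis.Continuum_Not_Denumerable"
begin

section \<open>Irreducibility and invariant subgroups of Q^n\<close>

lemma Q_irreducibleD:
  fixes W :: "rat vec set"
  assumes "Q_irreducible n A" "W \<subseteq> carrier_vec n" "0\<^sub>v n \<in> W"
    and "\<And>u v. u \<in> W \<Longrightarrow> v \<in> W \<Longrightarrow> u + v \<in> W"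
    and "\<And>c v. v \<in> W \<Longrightarrow> c \<cdot>\<^sub>v v \<in> W"
    and "\<And>v. v \<in> W \<Longrightarrow> A *\<^sub>v v \<in> W"
  shows "W = {0\<^sub>v n} \<or> W = carrier_vec n"
proof -
  have "LinearCombinations.submodule class_ring W (module_vec TYPE(rat) n)"
    unfolding LinearCombinations.submodule_def
    using assms by (auto simp: module_vec_simps vec_module)
  then have "VectorSpace.subspace class_ring W (module_vec TYPE(rat) n)"
    unfolding VectorSpace.subspace_def using vec_vs by blast
  with assms(1,6) show ?thesis
    unfolding Q_irreducible_def by blast
qed

lemma inv_rat_vec_group:
  assumes "v \<in> carrier_vec n"
  shows "inv\<^bsub>rat_vec_group n\<^esub> v = - v"
proof -
  interpret comm_group "rat_vec_group n" by (rule comm_group_vec)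
  show ?thesis
    by (rule inv_equality) (use assms in \<open>auto simp: monoid_vec_simps\<close>)
qed

lemma subgroup_rat_vec_group_iff:
  "subgroup S (rat_vec_group n) \<longleftrightarrow>
     S \<subseteq> carrier_vec n \<and> 0\<^sub>v n \<in> S \<and> (\<forall>u\<in>S. \<forall>v\<in>S. u + v \<in> S) \<and> (\<forall>v\<in>S. - v \<in> S)"
proof -
  have "inv\<^bsub>rat_vec_group n\<^esub> v = - v" if "S \<subseteq> carrier_vec n" "v \<in> S" for v
    using that inv_rat_vec_group by blast
  then show ?thesis
    by (auto simp: subgroup_def monoid_vec_simps)
qed

lemma subgroup_of_int_smult:
  assumes S: "subgroup S (rat_vec_group n)" and v: "v \<in> S"
  shows "rat_of_int k \<cdot>\<^sub>v v \<in> S"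
proof (induction k rule: int_induct[where k = 0])
  case base
  from S v have "v \<in> carrier_vec n" by (auto simp: subgroup_rat_vec_group_iff)
  then have "rat_of_int 0 \<cdot>\<^sub>v v = 0\<^sub>v n" by auto
  then show ?case using S by (simp add: subgroup_rat_vec_group_iff)
next
  case (step1 i)
  have "rat_of_int (i + 1) \<cdot>\<^sub>v v = rat_of_int i \<cdot>\<^sub>v v + v"
    by (rule eq_vecI) (auto simp: algebra_simps)
  then show ?case using step1 S v by (simp add: subgroup_rat_vec_group_iff)
next
  case (step2 i)
  have "rat_of_int (i - 1) \<cdot>\<^sub>v v = rat_of_int i \<cdot>\<^sub>v v + - v"
    by (rule eq_vecI) (auto simp: algebra_simps)
  then show ?case using step2 S v by (simp add: subgroup_rat_vec_group_iff)
qed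

text \<open>The vectors having a positive integer multiple in \<open>S\<close> form a Q-subspace:
  multipliers of two summands are multiplied together, and the denominator of a scalar is absorbed
  into the multiplier. This subspace is A-invariant and contains \<open>S\<close>, so irreducibility
  leaves only the whole space. It is applied both to \<open>H\<close> and to the kernel of the
  linear part.\<close>

lemma multiple_in_invariant_subgroup:
  assumes irr: "Q_irreducible n A" and A: "A \<in> carrier_mat n n"
    and S: "subgroup S (rat_vec_group n)" and inv: "\<And>v. v \<in> S \<Longrightarrow> A *\<^sub>v v \<in> S"
    and nz: "S \<noteq> {0\<^sub>v n}" and v: "v \<in> carrier_vec n"
  shows "\<exists>m>0. rat_of_int m \<cdot>\<^sub>v v \<in> S"
proof -
  note S' = S[unfolded subgroup_rat_vec_group_iff]
  define W where "W = {v \<in> carrier_vec n. \<exists>m>0. rat_of_int m \<cdot>\<^sub>v v \<in> S}"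
  have "S \<subseteq> W"
    using S' unfolding W_def by (auto intro!: exI[of _ 1])
  have "W = {0\<^sub>v n} \<or> W = carrier_vec n"
  proof (rule Q_irreducibleD[OF irr])
    show "W \<subseteq> carrier_vec n" by (auto simp: W_def)
    show "0\<^sub>v n \<in> W" using \<open>S \<subseteq> W\<close> S' by auto
  next
    fix u v assume "u \<in> W" "v \<in> W"
    then obtain k m where uv: "u \<in> carrier_vec n" "v \<in> carrier_vec n" and km: "k > 0" "m > 0"
      and S_uv: "rat_of_int k \<cdot>\<^sub>v u \<in> S" "rat_of_int m \<cdot>\<^sub>v v \<in> S"
      by (auto simp: W_def)
    have "rat_of_int (k * m) \<cdot>\<^sub>v (u + v) =
        rat_of_int m \<cdot>\<^sub>v (rat_of_int k \<cdot>\<^sub>v u) + rat_of_int k \<cdot>\<^sub>v (rat_of_int m \<cdot>\<^sub>v v)"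
      using uv by (intro eq_vecI) (auto simp: algebra_simps)
    also have "\<dots> \<in> S"
      using S' subgroup_of_int_smult[OF S] S_uv by blast
    finally show "u + v \<in> W"
      using uv km unfolding W_def by (auto intro!: exI[of _ "k * m"])
  next
    fix c v assume "v \<in> W"
    then obtain m where v: "v \<in> carrier_vec n" and m: "m > 0" and Sv: "rat_of_int m \<cdot>\<^sub>v v \<in> S"
      by (auto simp: W_def)
    obtain a b where ab: "quotient_of c = (a, b)" by fastforce
    then have b: "b > 0" and c: "c = rat_of_int a / rat_of_int b"
      by (auto simp: quotient_of_denom_pos quotient_of_div)
    have "rat_of_int (b * m) \<cdot>\<^sub>v (c \<cdot>\<^sub>v v) = rat_of_int a \<cdot>\<^sub>v (rat_of_int m \<cdot>\<^sub>v v)"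
      using b by (intro eq_vecI) (auto simp: c)
    also have "\<dots> \<in> S" by (rule subgroup_of_int_smult[OF S Sv])
    finally show "c \<cdot>\<^sub>v v \<in> W"
      using v b m unfolding W_def by (auto intro!: exI[of _ "b * m"])
  next
    fix v assume "v \<in> W"
    then obtain m where v: "v \<in> carrier_vec n" and m: "m > 0" and Sv: "rat_of_int m \<cdot>\<^sub>v v \<in> S"
      by (auto simp: W_def)
    have "rat_of_int m \<cdot>\<^sub>v (A *\<^sub>v v) = A *\<^sub>v (rat_of_int m \<cdot>\<^sub>v v)"
      using mult_mat_vec[OF A v] by simp
    then show "A *\<^sub>v v \<in> W"
      using inv[OF Sv] m v A unfolding W_def by (auto intro!: exI[of _ m])
  qed
  moreover have "W \<noteq> {0\<^sub>v n}"
    using \<open>S \<subseteq> W\<close> nz S' by auto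
  ultimately show ?thesis
    using v by (auto simp: W_def)
qed

section \<open>Q-linear functionals and left eigenvectors\<close>

definition Q_linear_on :: "nat \<Rightarrow> (rat vec \<Rightarrow> real) \<Rightarrow> bool" where
  "Q_linear_on n \<phi> \<longleftrightarrow>
     (\<forall>u\<in>carrier_vec n. \<forall>v\<in>carrier_vec n. \<phi> (u + v) = \<phi> u + \<phi> v) \<and>
     (\<forall>c. \<forall>v\<in>carrier_vec n. \<phi> (c \<cdot>\<^sub>v v) = of_rat c * \<phi> v)"

lemma Q_linear_on_zero:
  assumes "Q_linear_on n \<phi>"
  shows "\<phi> (0\<^sub>v n) = 0"
proof -
  have "\<phi> (0 \<cdot>\<^sub>v 0\<^sub>v n) = of_rat 0 * \<phi> (0\<^sub>v n)"
    using assms unfolding Q_linear_on_def by (metis zero_carrier_vec)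
  moreover have "0 \<cdot>\<^sub>v 0\<^sub>v n = (0\<^sub>v n :: rat vec)" by auto
  ultimately show ?thesis by simp
qed

lemma Q_linear_on_sum:
  assumes \<phi>: "Q_linear_on n \<phi>" and v: "v \<in> carrier_vec n"
  shows "\<phi> v = (\<Sum>i<n. of_rat (v $ i) * \<phi> (unit_vec n i))"
proof -
  \<comment> \<open>The induction runs over \<open>j\<close> for vectors supported on the first
    \<open>j\<close> coordinates; erasing the last of these coordinates leads back to the previous
    case.\<close>
  have "\<phi> v = (\<Sum>i<j. of_rat (v $ i) * \<phi> (unit_vec n i))"
    if "j \<le> n" "v \<in> carrier_vec n" "\<And>i. j \<le> i \<Longrightarrow> i < n \<Longrightarrow> v $ i = 0" for j v
    using that
  proof (induction j arbitrary: v)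
    case 0
    then have "v = 0\<^sub>v n" by auto
    then show ?case using Q_linear_on_zero[OF \<phi>] by simp
  next
    case (Suc j)
    define u where "u = vec n (\<lambda>i. if i = j then 0 else v $ i)"
    have u: "u \<in> carrier_vec n" by (simp add: u_def)
    have v: "v = u + (v $ j) \<cdot>\<^sub>v unit_vec n j"
      using Suc.prems by (intro eq_vecI) (auto simp: u_def)
    have "\<phi> v = \<phi> u + of_rat (v $ j) * \<phi> (unit_vec n j)"
      using \<phi> u by (subst v) (auto simp: Q_linear_on_def)
    also have "\<phi> u = (\<Sum>i<j. of_rat (u $ i) * \<phi> (unit_vec n i))"
    proof (rule Suc.IH[OF _ u])
      show "u $ i = 0" if "j \<le> i" "i < n" for i
        using that Suc.prems(3)[of i] by (cases "i = j") (auto simp: u_def)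
    qed (use Suc.prems in simp)
    also have "\<dots> = (\<Sum>i<j. of_rat (v $ i) * \<phi> (unit_vec n i))"
      using Suc.prems(1) by (intro sum.cong) (auto simp: u_def)
    finally show ?case by simp
  qed
  from this[of n v] v show ?thesis by simp
qed

text \<open>Eigenvalues are the roots of the characteristic polynomial, which transposition
  preserves. This passes from left eigenvectors, the form in which functionals appear, to
  eigenvalues of the matrix itself.\<close>

lemma eigenvalue_transpose:
  fixes B :: "'a :: field mat"
  assumes "B \<in> carrier_mat n n"
  shows "eigenvalue (transpose_mat B) l \<longleftrightarrow> eigenvalue B l"
  using assms by (simp add: eigenvalue_root_char_poly[of _ n])

text \<open>The values of \<phi> at the unit vectors form a left eigenvector \<open>w\<close>: entry
  \<open>i\<close> of the transpose applied to \<open>w\<close> is \<phi> of column \<open>i\<close>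
  of \<open>A\<close>, that is, \<phi> of the image of a unit vector. Since \<phi> is determined by
  these values, \<open>w\<close> cannot vanish.\<close>

lemma eigenvalue_if_functional:
  assumes A: "A \<in> carrier_mat n n" and \<phi>: "Q_linear_on n \<phi>"
    and eq: "\<And>v. v \<in> carrier_vec n \<Longrightarrow> \<phi> (A *\<^sub>v v) = l * \<phi> v"
    and u: "u \<in> carrier_vec n" "\<phi> u \<noteq> 0"
  shows "eigenvalue (map_mat real_of_rat A) l"
proof -
  let ?B = "map_mat real_of_rat A"
  define w where "w = vec n (\<lambda>i. \<phi> (unit_vec n i))"
  have "w \<noteq> 0\<^sub>v n"
  proof
    assume "w = 0\<^sub>v n"
    then have "\<phi> (unit_vec n i) = 0" if "i < n" for i
      using that unfolding w_def by (metis index_vec index_zero_vec(1))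
    then show False
      using Q_linear_on_sum[OF \<phi> u(1)] u(2) by simp
  qed
  have "transpose_mat ?B *\<^sub>v w = l \<cdot>\<^sub>v w"
  proof (rule eq_vecI)
    fix i assume "i < dim_vec (l \<cdot>\<^sub>v w)"
    then have i: "i < n" by (simp add: w_def)
    have "(transpose_mat ?B *\<^sub>v w) $ i = (\<Sum>j<n. of_rat (A $$ (j, i)) * \<phi> (unit_vec n j))"
      using A i by (auto simp: scalar_prod_def w_def lessThan_atLeast0 intro!: sum.cong)
    also have "\<dots> = \<phi> (col A i)"
      using A i by (subst Q_linear_on_sum[OF \<phi>]) (auto intro!: sum.cong)
    also have "col A i = A *\<^sub>v unit_vec n i"
      using A i by (intro eq_vecI) (auto simp: scalar_prod_right_unit)
    finally show "(transpose_mat ?B *\<^sub>v w) $ i = (l \<cdot>\<^sub>v w) $ i"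
      using i by (simp add: eq w_def)
  qed (use A in \<open>auto simp: w_def\<close>)
  then have "eigenvector (transpose_mat ?B) w l"
    using A \<open>w \<noteq> 0\<^sub>v n\<close> by (auto simp: eigenvector_def w_def)
  then have "eigenvalue (transpose_mat ?B) l"
    by (auto simp: eigenvalue_def)
  then show ?thesis
    using A eigenvalue_transpose[of ?B n l] by simp
qed

text \<open>The functional is the scalar product with a real left eigenvector \<open>w\<close>, and
  moving the matrix across the product gives the scaling by \<open>l\<close>. The witness
  \<open>u\<close> is a unit vector at a nonzero coordinate of \<open>w\<close>, where \<phi> takes
  that coordinate as its value.\<close>

lemma functional_if_eigenvalue:
  assumes A: "A \<in> carrier_mat n n" and ev: "eigenvalue (map_mat real_of_rat A) l"
  obtains \<phi> u where "Q_linear_on n \<phi>" "u \<in> carrier_vec n" "\<phi> u \<noteq> 0"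
    "\<And>v. v \<in> carrier_vec n \<Longrightarrow> \<phi> (A *\<^sub>v v) = l * \<phi> v"
proof -
  let ?B = "map_mat real_of_rat A"
  have B: "?B \<in> carrier_mat n n" using A by simp
  from ev have "eigenvalue (transpose_mat ?B) l"
    using eigenvalue_transpose[OF B] by simp
  then obtain w where w: "w \<in> carrier_vec n" "w \<noteq> 0\<^sub>v n" "transpose_mat ?B *\<^sub>v w = l \<cdot>\<^sub>v w"
    using B by (auto simp: eigenvalue_def eigenvector_def)
  define \<phi> where "\<phi> v = w \<bullet> map_vec real_of_rat v" for v
  obtain i where i: "i < n" "w $ i \<noteq> 0"
    using w(1,2) by (metis carrier_vecD eq_vecI index_zero_vec)
  show ?thesis
  proof (rule that)
    show "Q_linear_on n \<phi>"
      unfolding Q_linear_on_def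
    proof (intro conjI ballI allI)
      fix u v :: "rat vec" assume uv: "u \<in> carrier_vec n" "v \<in> carrier_vec n"
      have "map_vec real_of_rat (u + v) = map_vec real_of_rat u + map_vec real_of_rat v"
        using uv by (intro eq_vecI) (auto simp: of_rat_add)
      then show "\<phi> (u + v) = \<phi> u + \<phi> v"
        using w(1) uv by (simp add: \<phi>_def scalar_prod_add_distrib[of _ n])
    next
      fix c and v :: "rat vec" assume v: "v \<in> carrier_vec n"
      then show "\<phi> (c \<cdot>\<^sub>v v) = of_rat c * \<phi> v"
        using w(1) by (simp add: \<phi>_def of_rat_hom.vec_hom_smult)
    qed
    show "unit_vec n i \<in> carrier_vec n" by simp
    have "map_vec real_of_rat (unit_vec n i) = unit_vec n i"
      using i by (intro eq_vecI) (auto simp: unit_vec_def)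
    then show "\<phi> (unit_vec n i) \<noteq> 0"
      using i w(1) by (simp add: \<phi>_def scalar_prod_right_unit)
  next
    fix v :: "rat vec" assume v: "v \<in> carrier_vec n"
    have "\<phi> (A *\<^sub>v v) = w \<bullet> (?B *\<^sub>v map_vec real_of_rat v)"
      by (simp add: \<phi>_def of_rat_hom.mult_mat_vec_hom[OF A v])
    also have "\<dots> = (transpose_mat ?B *\<^sub>v w) \<bullet> map_vec real_of_rat v"
      using transpose_vec_mult_scalar[OF B, of "map_vec real_of_rat v" w] v w(1) by simp
    also have "\<dots> = l * \<phi> v"
      using v w(1) by (simp add: w(3) \<phi>_def)
    finally show "\<phi> (A *\<^sub>v v) = l * \<phi> v" .
  qed
qed

text \<open>Clearing denominators forces the extension: \<phi> at \<open>v\<close> must be \<tau> at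
  \<open>m v\<close> divided by \<open>m\<close>, for any \<open>m > 0\<close> with
  \<open>m v\<close> in \<open>S\<close>. Additivity of \<tau> makes this independent of
  \<open>m\<close>.\<close>

lemma Q_linear_extension:
  fixes \<tau> :: "rat vec \<Rightarrow> real"
  assumes S: "subgroup S (rat_vec_group n)"
    and mult: "\<And>v. v \<in> carrier_vec n \<Longrightarrow> \<exists>m>0. rat_of_int m \<cdot>\<^sub>v v \<in> S"
    and add: "\<And>u v. u \<in> S \<Longrightarrow> v \<in> S \<Longrightarrow> \<tau> (u + v) = \<tau> u + \<tau> v"
  obtains \<phi> where "Q_linear_on n \<phi>" "\<And>v. v \<in> S \<Longrightarrow> \<phi> v = \<tau> v"
proof -
  note S' = S[unfolded subgroup_rat_vec_group_iff]
  have \<tau>0: "\<tau> (0\<^sub>v n) = 0"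
    using add[of "0\<^sub>v n" "0\<^sub>v n"] S' by simp
  have \<tau>_int: "\<tau> (rat_of_int k \<cdot>\<^sub>v v) = of_int k * \<tau> v" if v: "v \<in> S" for k v
  proof (induction k rule: int_induct[where k = 0])
    case base
    from S' v have "v \<in> carrier_vec n" by auto
    then have "rat_of_int 0 \<cdot>\<^sub>v v = 0\<^sub>v n" by auto
    then show ?case using \<tau>0 by simp
  next
    case (step1 i)
    have "rat_of_int (i + 1) \<cdot>\<^sub>v v = rat_of_int i \<cdot>\<^sub>v v + v"
      by (rule eq_vecI) (auto simp: algebra_simps)
    then show ?case
      using step1 add[OF subgroup_of_int_smult[OF S v] v] by (simp add: algebra_simps)
  next
    case (step2 i)
    have "rat_of_int i \<cdot>\<^sub>v v = rat_of_int (i - 1) \<cdot>\<^sub>v v + v"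
      by (rule eq_vecI) (auto simp: algebra_simps)
    then show ?case
      using step2 add[OF subgroup_of_int_smult[OF S v] v, of "i - 1"] by (simp add: algebra_simps)
  qed
  define \<phi> where "\<phi> v = (let m = SOME m. m > 0 \<and> rat_of_int m \<cdot>\<^sub>v v \<in> S
                          in \<tau> (rat_of_int m \<cdot>\<^sub>v v) / of_int m)" for v
  \<comment> \<open>Any admissible multiplier \<open>k\<close> may replace the chosen
    \<open>m\<close>: \<tau> at \<open>k m v\<close> is computed once from \<open>m v\<close> and
    once from \<open>k v\<close>.\<close>
  have \<phi>_eq: "\<phi> v = \<tau> (rat_of_int k \<cdot>\<^sub>v v) / of_int k"
    if v: "v \<in> carrier_vec n" and k: "k > 0" "rat_of_int k \<cdot>\<^sub>v v \<in> S" for v k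
  proof -
    define m where "m = (SOME m. m > 0 \<and> rat_of_int m \<cdot>\<^sub>v v \<in> S)"
    have m: "m > 0" "rat_of_int m \<cdot>\<^sub>v v \<in> S"
      using someI_ex[OF mult[OF v]] by (auto simp: m_def)
    have "of_int k * \<tau> (rat_of_int m \<cdot>\<^sub>v v) = \<tau> (rat_of_int k \<cdot>\<^sub>v (rat_of_int m \<cdot>\<^sub>v v))"
      by (simp only: \<tau>_int[OF m(2)])
    also have "rat_of_int k \<cdot>\<^sub>v (rat_of_int m \<cdot>\<^sub>v v) = rat_of_int m \<cdot>\<^sub>v (rat_of_int k \<cdot>\<^sub>v v)"
      by (simp add: smult_smult_assoc mult.commute)
    also have "\<tau> \<dots> = of_int m * \<tau> (rat_of_int k \<cdot>\<^sub>v v)"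
      by (simp only: \<tau>_int[OF k(2)])
    finally show ?thesis
      using m(1) k(1) by (simp add: \<phi>_def m_def[symmetric] field_simps)
  qed
  show ?thesis
  proof (rule that)
    show "\<phi> v = \<tau> v" if "v \<in> S" for v
      using \<phi>_eq[of v 1] that S' by auto
    show "Q_linear_on n \<phi>"
      unfolding Q_linear_on_def
    proof (intro conjI ballI allI)
      fix u v :: "rat vec" assume uv: "u \<in> carrier_vec n" "v \<in> carrier_vec n"
      obtain k where k: "k > 0" "rat_of_int k \<cdot>\<^sub>v u \<in> S" using mult[OF uv(1)] by blast
      obtain m where m: "m > 0" "rat_of_int m \<cdot>\<^sub>v v \<in> S" using mult[OF uv(2)] by blast
      \<comment> \<open>The product \<open>k * m\<close> serves as a common multiplier for
        \<open>u\<close>, \<open>v\<close> and \<open>u + v\<close>.\<close>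
      have ku: "rat_of_int (k * m) \<cdot>\<^sub>v u \<in> S"
        using subgroup_of_int_smult[OF S k(2), of m] by (simp add: smult_smult_assoc mult.commute)
      have mv: "rat_of_int (k * m) \<cdot>\<^sub>v v \<in> S"
        using subgroup_of_int_smult[OF S m(2), of k] by (simp add: smult_smult_assoc)
      have eq: "rat_of_int (k * m) \<cdot>\<^sub>v (u + v) = rat_of_int (k * m) \<cdot>\<^sub>v u + rat_of_int (k * m) \<cdot>\<^sub>v v"
        using uv by (rule smult_add_distrib_vec)
      have pos: "k * m > 0" using k m by simp
      have "rat_of_int (k * m) \<cdot>\<^sub>v (u + v) \<in> S"
        using S' ku mv unfolding eq by blast
      then have "\<phi> (u + v) = \<tau> (rat_of_int (k * m) \<cdot>\<^sub>v (u + v)) / of_int (k * m)"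
        using uv pos by (intro \<phi>_eq) auto
      also have "\<dots> = \<phi> u + \<phi> v"
        unfolding eq add[OF ku mv] \<phi>_eq[OF uv(1) pos ku] \<phi>_eq[OF uv(2) pos mv]
        by (rule add_divide_distrib)
      finally show "\<phi> (u + v) = \<phi> u + \<phi> v" .
    next
      fix c and v :: "rat vec" assume v: "v \<in> carrier_vec n"
      obtain m where m: "m > 0" "rat_of_int m \<cdot>\<^sub>v v \<in> S" using mult[OF v] by blast
      obtain a b where ab: "quotient_of c = (a, b)" by fastforce
      then have b: "b > 0" and c: "c = rat_of_int a / rat_of_int b"
        by (auto simp: quotient_of_denom_pos quotient_of_div)
      \<comment> \<open>Here \<open>b\<close> clears the denominator of \<open>c\<close> and
        \<open>m\<close> brings \<open>v\<close> into \<open>S\<close>.\<close>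
      have eq: "rat_of_int (b * m) \<cdot>\<^sub>v (c \<cdot>\<^sub>v v) = rat_of_int a \<cdot>\<^sub>v (rat_of_int m \<cdot>\<^sub>v v)"
        using b by (intro eq_vecI) (auto simp: c)
      have "rat_of_int (b * m) \<cdot>\<^sub>v (c \<cdot>\<^sub>v v) \<in> S"
        unfolding eq by (rule subgroup_of_int_smult[OF S m(2)])
      then have "\<phi> (c \<cdot>\<^sub>v v) = \<tau> (rat_of_int (b * m) \<cdot>\<^sub>v (c \<cdot>\<^sub>v v)) / of_int (b * m)"
        using b m(1) v by (intro \<phi>_eq) auto
      also have "\<dots> = of_int a * \<tau> (rat_of_int m \<cdot>\<^sub>v v) / of_int (b * m)"
        unfolding eq \<tau>_int[OF m(2)] ..
      also have "\<dots> = of_rat c * \<phi> v"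
        using b m(1) unfolding \<phi>_eq[OF v m] by (simp add: c of_rat_divide)
      finally show "\<phi> (c \<cdot>\<^sub>v v) = of_rat c * \<phi> v" .
    qed
  qed
qed

section \<open>Integer powers of the matrix and the semidirect product\<close>

lemma group_GL_rat: "group (GL_rat n)"
proof -
  interpret ring "ring_mat TYPE(rat) n ()" by (rule ring_mat)
  show ?thesis unfolding GL_rat_def by (rule units_group)
qed

lemma GL_rat_simps:
  "monoid.mult (GL_rat n) = (*)" "one (GL_rat n) = 1\<^sub>m n"
  by (simp_all add: GL_rat_def units_of_mult units_of_one ring_mat_simps)

lemma carrier_GL_ratD: "A \<in> carrier (GL_rat n) \<Longrightarrow> A \<in> carrier_mat n n"
  by (auto simp: GL_rat_def units_of_carrier Units_def ring_mat_simps)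

lemma GL_rat_int_pow_closed:
  "A \<in> carrier (GL_rat n) \<Longrightarrow> A [^]\<^bsub>GL_rat n\<^esub> (k :: int) \<in> carrier_mat n n"
  by (simp add: carrier_GL_ratD group.int_pow_closed[OF group_GL_rat])

lemma GL_rat_int_pow_add_1:
  assumes "A \<in> carrier (GL_rat n)"
  shows "A [^]\<^bsub>GL_rat n\<^esub> (k + 1 :: int) = A * A [^]\<^bsub>GL_rat n\<^esub> k"
proof -
  interpret group "GL_rat n" by (rule group_GL_rat)
  have "A [^]\<^bsub>GL_rat n\<^esub> (1 + k) = A [^]\<^bsub>GL_rat n\<^esub> (1 :: int) \<otimes>\<^bsub>GL_rat n\<^esub> A [^]\<^bsub>GL_rat n\<^esub> k"
    using assms by (rule int_pow_mult)
  then show ?thesis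
    using assms by (simp add: GL_rat_simps add.commute)
qed

text \<open>The relation between exponents \<open>i\<close> and \<open>i + 1\<close> holds for every
  integer \<open>i\<close>. It is read upwards for positive exponents and, after cancelling
  \<open>l\<close>, downwards for negative ones.\<close>

lemma functional_int_pow:
  fixes \<phi> :: "rat vec \<Rightarrow> real"
  assumes A: "A \<in> carrier (GL_rat n)" and l: "l \<noteq> 0"
    and eq: "\<And>v. v \<in> carrier_vec n \<Longrightarrow> \<phi> (A *\<^sub>v v) = l * \<phi> v"
    and v: "v \<in> carrier_vec n"
  shows "\<phi> ((A [^]\<^bsub>GL_rat n\<^esub> (k :: int)) *\<^sub>v v) = l powi k * \<phi> v"
proof -
  note carr = GL_rat_int_pow_closed[OF A] carrier_GL_ratD[OF A]
  have step: "\<phi> ((A [^]\<^bsub>GL_rat n\<^esub> (i + 1)) *\<^sub>v v) = l * \<phi> ((A [^]\<^bsub>GL_rat n\<^esub> i) *\<^sub>v v)" for i :: int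
  proof -
    have "(A [^]\<^bsub>GL_rat n\<^esub> (i + 1)) *\<^sub>v v = A *\<^sub>v ((A [^]\<^bsub>GL_rat n\<^esub> i) *\<^sub>v v)"
      unfolding GL_rat_int_pow_add_1[OF A] using carr v by (intro assoc_mult_mat_vec)
    moreover have "(A [^]\<^bsub>GL_rat n\<^esub> i) *\<^sub>v v \<in> carrier_vec n"
      using carr v by (intro mult_mat_vec_carrier)
    ultimately show ?thesis using eq by simp
  qed
  show ?thesis
  proof (induction k rule: int_induct[where k = 0])
    case base
    then show ?case using v by (simp add: GL_rat_simps)
  next
    case (step1 i)
    then show ?case using step[of i] l by (simp add: power_int_add_1')
  next
    case (step2 i)
    have "l * \<phi> ((A [^]\<^bsub>GL_rat n\<^esub> (i - 1)) *\<^sub>v v) = l * (l powi (i - 1) * \<phi> v)"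
      using step2 step[of "i - 1"] l power_int_add_1'[of l "i - 1"] by simp
    then show ?case using l by simp
  qed
qed

lemma carrier_Z_semidirect: "carrier (Z_semidirect n A H) = UNIV \<times> H"
  by (simp add: Z_semidirect_def semidirect_product_def)

lemma mult_Z_semidirect:
  "(k, x) \<otimes>\<^bsub>Z_semidirect n A H\<^esub> (l, y) = (k + l, x + (A [^]\<^bsub>GL_rat n\<^esub> k) *\<^sub>v y)"
  by (simp add: Z_semidirect_def semidirect_product_def monoid_vec_simps)

text \<open>Evaluation at \<open>0\<close> and \<open>1\<close> recovers both coefficients, so each
  identity between composed affine maps splits into one for linear parts and one for translation
  parts.\<close>

lemma affine_map_eq_iff:
  fixes a b s t :: real
  shows "(\<lambda>x. a * x + s) = (\<lambda>x. b * x + t) \<longleftrightarrow> a = b \<and> s = t"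
proof
  assume eq: "(\<lambda>x. a * x + s) = (\<lambda>x. b * x + t)"
  show "a = b \<and> s = t"
    using fun_cong[OF eq, of 0] fun_cong[OF eq, of 1] by simp
qed simp

section \<open>From a positive eigenvalue to a faithful affine action\<close>

lemma countable_carrier_vec: "countable (carrier_vec n :: rat vec set)"
proof -
  have "inj (list_of_vec :: rat vec \<Rightarrow> rat list)"
    by (rule inj_on_inverseI[of _ vec_of_list]) (simp add: vec_list)
  then show ?thesis
    by (metis countableI_type countable_image_inj_on inj_on_subset subset_UNIV)
qed

text \<open>Only countably many reals are of the form \<phi> at \<open>v\<close> divided by
  \<open>k\<close>, so some \<open>t\<close> avoids them all. It serves the eigenvalue
  \<open>1\<close>, where linear parts cannot distinguish the powers of the generator.\<close>

lemma exists_free_translation: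
  fixes \<phi> :: "rat vec \<Rightarrow> real"
  obtains t where "\<And>k v. k \<noteq> 0 \<Longrightarrow> v \<in> carrier_vec n \<Longrightarrow> of_int k * t \<noteq> \<phi> v"
proof -
  \<comment> \<open>Pairs with \<open>k = 0\<close> only add the value \<open>0\<close>, by the
    convention for division by zero.\<close>
  have "countable ((\<lambda>(k, v). \<phi> v / of_int k) ` ((UNIV :: int set) \<times> carrier_vec n))"
    by (intro countable_image countable_SIGMA countable_carrier_vec) auto
  then obtain t where t: "t \<notin> (\<lambda>(k, v). \<phi> v / of_int k) ` ((UNIV :: int set) \<times> carrier_vec n)"
    using uncountable_UNIV_real by (metis UNIV_eq_I)
  show ?thesis
  proof (rule that)
    fix k :: int and v :: "rat vec"
    assume k: "k \<noteq> 0" and v: "v \<in> carrier_vec n"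
    show "of_int k * t \<noteq> \<phi> v"
    proof
      assume "of_int k * t = \<phi> v"
      with k have "t = \<phi> v / of_int k" by (simp add: field_simps)
      with v t show False by force
    qed
  qed
qed

lemma Q_linear_on_diff:
  assumes "Q_linear_on n \<phi>" "u \<in> carrier_vec n" "v \<in> carrier_vec n"
  shows "\<phi> (u - v) = \<phi> u - \<phi> v"
proof -
  have "u - v = u + (- 1) \<cdot>\<^sub>v v"
    using assms by (intro eq_vecI) auto
  then show ?thesis
    using assms unfolding Q_linear_on_def by simp
qed

lemma eq_if_diff_eq_zero_vec:
  fixes u v :: "'a :: group_add vec"
  assumes "u - v = 0\<^sub>v n" "u \<in> carrier_vec n" "v \<in> carrier_vec n"
  shows "u = v"
proof (rule eq_vecI)
  fix i assume "i < dim_vec v"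
  then have "u $ i - v $ i = 0"
    using arg_cong[OF assms(1), of "\<lambda>w. w $ i"] assms(2,3) by simp
  then show "u $ i = v $ i" by simp
qed (use assms(2,3) in simp)

lemma faithful_affine_action_if_eigenvalue:
  assumes A: "A \<in> carrier (GL_rat n)" and irr: "Q_irreducible n A"
    and H: "H \<subseteq> carrier_vec n"
    and l: "l > 0" "eigenvalue (map_mat real_of_rat A) l"
  shows "\<exists>\<rho>. \<rho> \<in> mon (Z_semidirect n A H) Aff_plus"
proof -
  note Ac = carrier_GL_ratD[OF A]
  obtain \<phi> u where \<phi>: "Q_linear_on n \<phi>" and u: "u \<in> carrier_vec n" "\<phi> u \<noteq> 0"
    and eq: "\<And>v. v \<in> carrier_vec n \<Longrightarrow> \<phi> (A *\<^sub>v v) = l * \<phi> v"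
    using functional_if_eigenvalue[OF Ac l(2)] by blast
  have \<phi>_pow: "\<phi> ((A [^]\<^bsub>GL_rat n\<^esub> k) *\<^sub>v v) = l powi k * \<phi> v"
    if "v \<in> carrier_vec n" for k :: int and v
    by (rule functional_int_pow[where \<phi> = \<phi>, OF A _ eq that]) (use l(1) in simp_all)
  have ker: "v = 0\<^sub>v n" if "v \<in> carrier_vec n" "\<phi> v = 0" for v
  proof -
    let ?W = "{v \<in> carrier_vec n. \<phi> v = 0}"
    have "?W = {0\<^sub>v n} \<or> ?W = carrier_vec n"
      using \<phi> Q_linear_on_zero[OF \<phi>] Ac eq
      by (intro Q_irreducibleD[OF irr]) (auto simp: Q_linear_on_def)
    then show ?thesis using that u by blast
  qed
  obtain t0 where t0: "\<And>k v. k \<noteq> 0 \<Longrightarrow> v \<in> carrier_vec n \<Longrightarrow> of_int k * t0 \<noteq> \<phi> v"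
    using exists_free_translation[of n \<phi>] by blast
  \<comment> \<open>The homomorphism law requires \<open>l powi k * (j * t) = j * t\<close>, which
    forces \<open>t = 0\<close> as soon as \<open>l\<close> differs from \<open>1\<close>.\<close>
  define t where "t = (if l = 1 then t0 else 0)"
  \<comment> \<open>The pair stands for \<open>v\<close> times the \<open>k\<close>-th power of the
    generator, so the power acts first and the translation by \<phi> at \<open>v\<close>
    follows.\<close>
  define \<rho> where "\<rho> = (\<lambda>(k, v). (\<lambda>x. l powi k * x + (\<phi> v + of_int k * t)))"
  have "\<rho> \<in> hom (Z_semidirect n A H) Aff_plus"
  proof (rule homI)
    fix g assume "g \<in> carrier (Z_semidirect n A H)"
    then show "\<rho> g \<in> carrier Aff_plus"
      using l(1) unfolding Aff_plus_def
      by (cases g) (auto simp: \<rho>_def affine_map_eq_iff)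
  next
    fix g h assume g: "g \<in> carrier (Z_semidirect n A H)" and h: "h \<in> carrier (Z_semidirect n A H)"
    obtain k v where g': "g = (k, v)" "v \<in> carrier_vec n"
      using g H by (cases g) (auto simp: carrier_Z_semidirect)
    obtain j w where h': "h = (j, w)" "w \<in> carrier_vec n"
      using h H by (cases h) (auto simp: carrier_Z_semidirect)
    have "(A [^]\<^bsub>GL_rat n\<^esub> k) *\<^sub>v w \<in> carrier_vec n"
      using GL_rat_int_pow_closed[OF A] h'(2) by (intro mult_mat_vec_carrier)
    then have "\<phi> (v + (A [^]\<^bsub>GL_rat n\<^esub> k) *\<^sub>v w) = \<phi> v + l powi k * \<phi> w"
      using \<phi> g' h' \<phi>_pow l(1) by (simp add: Q_linear_on_def)
    moreover have "l powi k * (of_int j * t) = of_int j * t"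
      by (simp add: t_def)
    ultimately show "\<rho> (g \<otimes>\<^bsub>Z_semidirect n A H\<^esub> h) = \<rho> g \<otimes>\<^bsub>Aff_plus\<^esub> \<rho> h"
      using l(1) unfolding g' h'
      by (auto simp: \<rho>_def Aff_plus_def mult_Z_semidirect power_int_add algebra_simps)
  qed
  moreover have "inj_on \<rho> (carrier (Z_semidirect n A H))"
  proof (rule inj_onI)
    fix g h
    assume g: "g \<in> carrier (Z_semidirect n A H)" and h: "h \<in> carrier (Z_semidirect n A H)"
      and \<rho>: "\<rho> g = \<rho> h"
    obtain k v where g': "g = (k, v)" "v \<in> carrier_vec n"
      using g H by (cases g) (auto simp: carrier_Z_semidirect)
    obtain j w where h': "h = (j, w)" "w \<in> carrier_vec n"
      using h H by (cases h) (auto simp: carrier_Z_semidirect)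
    from \<rho> have pow: "l powi k = l powi j" and tr: "\<phi> v + of_int k * t = \<phi> w + of_int j * t"
      by (simp_all add: g' h' \<rho>_def affine_map_eq_iff)
    have "k = j"
    proof (cases "l = 1")
      case True
      \<comment> \<open>All linear parts are \<open>1\<close> here. Equal translation parts put a
        multiple of \<open>t0\<close> into the image of \<phi>, which the choice of
        \<open>t0\<close> allows only for the multiple zero.\<close>
      have "of_int (k - j) * t0 = \<phi> (w - v)"
        using tr True by (simp add: t_def Q_linear_on_diff[OF \<phi> h'(2) g'(2)] algebra_simps)
      then show ?thesis
        using t0[of "k - j" "w - v"] g' h' by auto
    next
      case False
      \<comment> \<open>A positive base other than \<open>1\<close> has distinct powers, so the
        linear parts already determine the exponent.\<close>
      have "l powr of_int k = l powr of_int j"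
        using pow l(1) by (simp add: powr_real_of_int')
      then show ?thesis using False l(1) powr_inj by simp
    qed
    with tr have "\<phi> (v - w) = 0"
      by (simp add: Q_linear_on_diff[OF \<phi> g'(2) h'(2)])
    then have "v - w = 0\<^sub>v n"
      using ker g' h' by simp
    then have "v = w"
      using g'(2) h'(2) by (rule eq_if_diff_eq_zero_vec)
    with \<open>k = j\<close> show "g = h" by (simp add: g' h')
  qed
  ultimately show ?thesis by (auto simp: mon_def)
qed

section \<open>From a faithful affine action to a positive eigenvalue\<close>

lemma eigenvalue_if_faithful_affine_action:
  assumes A: "A \<in> carrier (GL_rat n)" and irr: "Q_irreducible n A"
    and H: "subgroup H (rat_vec_group n)" and AH: "\<And>h. h \<in> H \<Longrightarrow> A *\<^sub>v h \<in> H"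
    and nz: "H \<noteq> {0\<^sub>v n}"
    and \<rho>: "\<rho> \<in> mon (Z_semidirect n A H) Aff_plus"
  shows "\<exists>l>0. eigenvalue (map_mat real_of_rat A) l"
proof -
  note Ac = carrier_GL_ratD[OF A]
  note H' = H[unfolded subgroup_rat_vec_group_iff]
  have Hc: "h \<in> carrier_vec n" if "h \<in> H" for h using that H' by auto
  interpret GL: group "GL_rat n" by (rule group_GL_rat)
  have inj: "inj_on \<rho> (UNIV \<times> H)"
    using \<rho> by (simp add: mon_def carrier_Z_semidirect)
  have comp: "\<rho> (k + j, x + (A [^]\<^bsub>GL_rat n\<^esub> k) *\<^sub>v y) = \<rho> (k, x) \<circ> \<rho> (j, y)"
    if "x \<in> H" "y \<in> H" for k j x y
    using \<rho> that hom_mult[of \<rho> "Z_semidirect n A H" Aff_plus "(k, x)" "(j, y)"]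
    by (simp add: mon_def carrier_Z_semidirect mult_Z_semidirect Aff_plus_def)
  \<comment> \<open>The values at \<open>0\<close> and \<open>1\<close> give the linear part
    \<open>L\<close> and the translation part \<open>T\<close> of the image of each element.\<close>
  define L T where "L k h = \<rho> (k, h) 1 - \<rho> (k, h) 0" and "T k h = \<rho> (k, h) 0" for k h
  have LT: "L k h > 0 \<and> \<rho> (k, h) = (\<lambda>x. L k h * x + T k h)" if "h \<in> H" for k h
  proof -
    have "\<rho> (k, h) \<in> carrier Aff_plus"
      using \<rho> that hom_in_carrier[of \<rho> "Z_semidirect n A H" Aff_plus "(k, h)"]
      by (simp add: mon_def carrier_Z_semidirect)
    then obtain l s where "l > 0" "\<rho> (k, h) = (\<lambda>x. l * x + s)"
      by (auto simp: Aff_plus_def)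
    then show ?thesis by (simp add: L_def T_def)
  qed
  then have L: "L k h > 0" and \<rho>_eq: "\<rho> (k, h) = (\<lambda>x. L k h * x + T k h)" if "h \<in> H" for k h
    using that by blast+
  define \<chi> \<tau> l where "\<chi> = L 0" and "\<tau> = T 0" and "l = L 1 (0\<^sub>v n)"
  \<comment> \<open>On \<open>H\<close> the linear part \<chi> is multiplicative and \<tau> is a
    cocycle for it; \<tau> becomes additive once \<chi> is known to be trivial.\<close>
  have comp0: "\<chi> (u + v) = \<chi> u * \<chi> v" "\<tau> (u + v) = \<chi> u * \<tau> v + \<tau> u" if "u \<in> H" "v \<in> H" for u v
  proof -
    have "u + v \<in> H" using H' that by blast
    then have "(\<lambda>x. \<chi> (u + v) * x + \<tau> (u + v)) = (\<lambda>x. (\<chi> u * \<chi> v) * x + (\<chi> u * \<tau> v + \<tau> u))"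
      using comp[OF that, of 0 0] that Hc
      by (simp add: GL_rat_simps \<rho>_eq \<chi>_def \<tau>_def o_def algebra_simps)
    then show "\<chi> (u + v) = \<chi> u * \<chi> v" "\<tau> (u + v) = \<chi> u * \<tau> v + \<tau> u"
      unfolding affine_map_eq_iff by simp_all
  qed
  have conj: "\<chi> (A *\<^sub>v h) = \<chi> h \<and> (\<chi> h = 1 \<longrightarrow> \<tau> (A *\<^sub>v h) = l * \<tau> h)" if h: "h \<in> H" for h
  proof -
    have z: "0\<^sub>v n \<in> H" using H' by simp
    let ?s = "T 1 (0\<^sub>v n)"
    \<comment> \<open>Both sides are the image of \<open>(1, A *\<^sub>v h)\<close>: this is the
      conjugation relation written without inverses. Comparing linear parts and cancelling
      \<open>l\<close> gives invariance of \<chi>; comparing translation parts, \<open>?s\<close>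
      cancels when \<chi> is \<open>1\<close> at \<open>h\<close>.\<close>
    have "\<rho> (1, 0\<^sub>v n) \<circ> \<rho> (0, h) = \<rho> (0, A *\<^sub>v h) \<circ> \<rho> (1, 0\<^sub>v n)"
      using comp[OF z h, of 1 0] comp[OF AH[OF h] z, of 0 1] A Ac Hc[OF h] Hc[OF AH[OF h]]
      by (simp add: GL_rat_simps)
    then have "(\<lambda>x. (l * \<chi> h) * x + (l * \<tau> h + ?s)) =
        (\<lambda>x. (\<chi> (A *\<^sub>v h) * l) * x + (\<chi> (A *\<^sub>v h) * ?s + \<tau> (A *\<^sub>v h)))"
      using h AH[OF h] z by (simp add: \<rho>_eq \<chi>_def \<tau>_def l_def o_def algebra_simps)
    then have "l * \<chi> h = \<chi> (A *\<^sub>v h) * l" "l * \<tau> h + ?s = \<chi> (A *\<^sub>v h) * ?s + \<tau> (A *\<^sub>v h)"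
      unfolding affine_map_eq_iff by simp_all
    then show ?thesis using L[OF z, of 1] by (auto simp: l_def)
  qed
  have \<chi>0: "\<chi> (0\<^sub>v n) = 1"
    using comp0(1)[of "0\<^sub>v n" "0\<^sub>v n"] H' L[of "0\<^sub>v n" 0] by (simp add: \<chi>_def)
  have \<chi>_uminus: "\<chi> (- h) * \<chi> h = 1" if "h \<in> H" for h
  proof -
    have "- h + h = 0\<^sub>v n" using Hc[OF that] by simp
    then show ?thesis using comp0(1)[of "- h" h] that H' \<chi>0 by simp
  qed
  define K where "K = {h \<in> H. \<chi> h = 1}"
  have K: "subgroup K (rat_vec_group n)"
    unfolding subgroup_rat_vec_group_iff
  proof (intro conjI ballI)
    show "- v \<in> K" if "v \<in> K" for v
      using that H' \<chi>_uminus[of v] by (auto simp: K_def)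
  qed (use H' \<chi>0 comp0(1) in \<open>auto simp: K_def\<close>)
  show ?thesis
  proof (cases "K = {0\<^sub>v n}")
    \<comment> \<open>This case does occur: for \<open>n = 1\<close>, \<open>A\<close> the identity
      and \<open>H\<close> the integers, let \<open>(k, h)\<close> act as multiplication by 3^k
      2^h.\<close>
    case True
    have fixed: "A *\<^sub>v h = h" if h: "h \<in> H" for h
    proof -
      have "A *\<^sub>v h + - h \<in> H" using H' h AH by blast
      moreover have "\<chi> (A *\<^sub>v h + - h) = 1"
      proof -
        have "- h \<in> H" using H' h by blast
        then have "\<chi> (A *\<^sub>v h + - h) = \<chi> (A *\<^sub>v h) * \<chi> (- h)"
          by (rule comp0(1)[OF AH[OF h]])
        also have "\<dots> = \<chi> (- h) * \<chi> h" using conj[OF h] by (simp add: mult.commute)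
        finally show ?thesis using \<chi>_uminus[OF h] by simp
      qed
      ultimately have "A *\<^sub>v h + - h \<in> K"
        unfolding K_def by blast
      then have "A *\<^sub>v h - h = 0\<^sub>v n"
        unfolding minus_add_uminus_vec[OF Hc[OF AH[OF h]] Hc[OF h]] True by (rule singletonD)
      then show ?thesis
        using Hc[OF AH[OF h]] Hc[OF h] by (rule eq_if_diff_eq_zero_vec)
    qed
    obtain h where h: "h \<in> H" "h \<noteq> 0\<^sub>v n"
      using nz H' by blast
    have "eigenvector A h 1"
      using h Hc fixed Ac by (auto simp: eigenvector_def)
    then have "eigenvector (map_mat real_of_rat A) (map_vec real_of_rat h) (of_rat 1)"
      by (rule of_rat_hom.eigenvector_hom[OF Ac])
    then show ?thesis
      by (auto simp: eigenvalue_def intro!: exI[of _ 1])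
  next
    case False
    have \<chi>1: "\<chi> h = 1" if h: "h \<in> H" for h
    proof -
      have \<chi>_nat: "\<chi> (rat_of_int (int k) \<cdot>\<^sub>v h) = \<chi> h ^ k" for k
      proof (induction k)
        case 0
        have "0 \<cdot>\<^sub>v h = 0\<^sub>v n" using Hc[OF h] by auto
        then show ?case using \<chi>0 by simp
      next
        case (Suc k)
        have "rat_of_int (int (Suc k)) \<cdot>\<^sub>v h = h + rat_of_int (int k) \<cdot>\<^sub>v h"
          by (rule eq_vecI) (auto simp: algebra_simps)
        then show ?case
          using comp0(1)[OF h subgroup_of_int_smult[OF H h], of "int k"] Suc by simp
      qed
      \<comment> \<open>Invariance of \<chi> under \<open>A\<close> makes \<open>K\<close> an
        A-invariant subgroup, and it is nonzero in this case, so some positive multiple of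
        \<open>h\<close> lies in it. Then \<chi> at \<open>h\<close> is a positive real with a
        positive power equal to \<open>1\<close>.\<close>
      obtain m where m: "m > 0" "rat_of_int m \<cdot>\<^sub>v h \<in> K"
        using multiple_in_invariant_subgroup[OF irr Ac K _ False Hc[OF h]] conj AH
        by (auto simp: K_def)
      then have "\<chi> h ^ nat m = 1" using \<chi>_nat[of "nat m"] by (simp add: K_def)
      then show ?thesis
        using m(1) L[OF h, of 0] power_eq_imp_eq_base[of "\<chi> h" "nat m" 1] by (simp add: \<chi>_def)
    qed
    have mult: "\<exists>m>0. rat_of_int m \<cdot>\<^sub>v v \<in> H" if "v \<in> carrier_vec n" for v
      using multiple_in_invariant_subgroup[OF irr Ac H AH nz that] by blast
    have add: "\<tau> (u + v) = \<tau> u + \<tau> v" if "u \<in> H" "v \<in> H" for u v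
      using comp0(2)[OF that] \<chi>1[OF that(1)] by simp
    obtain \<phi> where \<phi>: "Q_linear_on n \<phi>" and \<phi>_\<tau>: "\<And>v. v \<in> H \<Longrightarrow> \<phi> v = \<tau> v"
      using Q_linear_extension[OF H mult add] by blast
    \<comment> \<open>The scaling by \<open>l\<close> is known on \<open>H\<close>; it reaches an
      arbitrary \<open>v\<close> through a multiple \<open>m v\<close> in \<open>H\<close> and
      division by \<open>m\<close>.\<close>
    have "\<phi> (A *\<^sub>v v) = l * \<phi> v" if v: "v \<in> carrier_vec n" for v
    proof -
      obtain m where m: "m > 0" "rat_of_int m \<cdot>\<^sub>v v \<in> H" using mult[OF v] by blast
      have "of_int m * \<phi> (A *\<^sub>v v) = \<phi> (A *\<^sub>v (rat_of_int m \<cdot>\<^sub>v v))"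
        using \<phi> v Ac mult_mat_vec[OF Ac v] by (simp add: Q_linear_on_def)
      also have "\<dots> = l * \<phi> (rat_of_int m \<cdot>\<^sub>v v)"
        using m(2) AH conj \<chi>1 \<phi>_\<tau> by simp
      also have "\<dots> = of_int m * (l * \<phi> v)"
        using \<phi> v by (simp add: Q_linear_on_def)
      finally show ?thesis using m(1) by simp
    qed
    moreover obtain h where h: "h \<in> H" "h \<noteq> 0\<^sub>v n"
      using nz H' by blast
    \<comment> \<open>Otherwise \<open>h\<close> would act as the identity, like the zero vector.
      This is the point where injectivity of \<rho> enters.\<close>
    have "\<phi> h \<noteq> 0"
    proof
      assume "\<phi> h = 0"
      with \<phi>_\<tau> h have "\<tau> h = 0" by simp
      moreover have "\<tau> (0\<^sub>v n) = 0" using add[of "0\<^sub>v n" "0\<^sub>v n"] H' by simp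
      ultimately have "\<rho> (0, h) = \<rho> (0, 0\<^sub>v n)"
        using h H' \<chi>1 by (simp add: \<rho>_eq \<chi>_def \<tau>_def)
      then show False
        using inj_onD[OF inj, of "(0, h)" "(0, 0\<^sub>v n)"] h H' by simp
    qed
    ultimately have "eigenvalue (map_mat real_of_rat A) l"
      using eigenvalue_if_functional[OF Ac \<phi> _ Hc[OF h(1)]] by blast
    moreover have "l > 0" using L H' by (simp add: l_def)
    ultimately show ?thesis by blast
  qed
qed

section \<open>The Q-rank and the equivalence\<close>

lemma Q_rank_trivial: "Q_rank ((rat_vec_group n)\<lparr>carrier := {0\<^sub>v n}\<rparr>) = 0"
proof -
  \<comment> \<open>A map on a one-element group is injective, so dimension \<open>0\<close> is
    already admissible for the minimum.\<close>
  have "(\<lambda>_. 0\<^sub>v 0) \<in> mon ((rat_vec_group n)\<lparr>carrier := {0\<^sub>v n}\<rparr>) (rat_vec_group 0)"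
    by (auto simp: mon_def hom_def monoid_vec_simps)
  then show ?thesis
    unfolding Q_rank_def by (intro Least_eq_0) blast
qed

theorem proposition1p2:
  fixes d :: nat and A :: "rat mat" and H :: "rat vec set"
  assumes "d \<ge> 1"
    and "A \<in> carrier (GL_rat d)"
    and "Q_irreducible d A"
    and "subgroup H (rat_vec_group d)"
    and "(\<lambda>v. A *\<^sub>v v) ` H = H"
    and "Q_rank ((rat_vec_group d)\<lparr>carrier := H\<rparr>) = d"
  shows "(\<exists>\<rho>. \<rho> \<in> mon (Z_semidirect d A H) Aff_plus) \<longleftrightarrow>
         (\<exists>l > 0. eigenvalue (map_mat real_of_rat A) l)"
proof
  \<comment> \<open>The rank hypothesis enters here: rank \<open>d\<close> with \<open>d\<close> at
    least \<open>1\<close> excludes the trivial group. From nonzero \<open>H\<close>, irreducibility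
    yields that every rational vector has a positive integer multiple in \<open>H\<close>.\<close>
  have nz: "H \<noteq> {0\<^sub>v d}"
    using assms(1,6) Q_rank_trivial[of d] by auto
  assume "\<exists>\<rho>. \<rho> \<in> mon (Z_semidirect d A H) Aff_plus"
  then show "\<exists>l > 0. eigenvalue (map_mat real_of_rat A) l"
    using eigenvalue_if_faithful_affine_action[OF assms(2,3,4) _ nz] assms(5) by blast
next
  assume "\<exists>l > 0. eigenvalue (map_mat real_of_rat A) l"
  then show "\<exists>\<rho>. \<rho> \<in> mon (Z_semidirect d A H) Aff_plus"
    using faithful_affine_action_if_eigenvalue[OF assms(2,3)] assms(4)
    by (auto simp: subgroup_rat_vec_group_iff)
qed

end
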